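(* Let $(M,g,\boldsymbol{\tau})$ be a parallelizable spacetime. Then the set of sections $\mathsf{Sec}(\mathcal{N}M)$ of the null tangent bundle carries the structure of a partial semiheap, given by $$[\boldsymbol{u},\boldsymbol{v},\boldsymbol{w}] := \boldsymbol{u}\, g(\boldsymbol{v},\boldsymbol{w}),$$ which is only defined when $\boldsymbol{v}_p$ and $\boldsymbol{w}_p$ are not proportional to each other for all points $p\in M$ (i.e. at every point $p \in M$ the vectors $\boldsymbol{v}_p$ and $\boldsymbol{w}_p$ are not proportional).
   Context: A spacetime $(M,g,\boldsymbol{\tau})$ is a connected four-dimensional smooth manifold $M$ with a Lorentzian metric $g$ of signature $(-,+,+,+)$ and a chosen timelike vector field $\boldsymbol{\tau}$ (the time-orientation), i.e. $g_p(\boldsymbol{\tau}|_p,\boldsymbol{\tau}|_p)<0$ at every $p\in M$. It is parallelizable if $M$ admits a global frame of vector fields. A vector $v \in T_pM$ is null if $g_p(v,v)=0$; $\mathcal{N}_p\subset T_pM$ is the set of null vectors at $p$. The null tangent bundle is $\mathcal{N}M = \bigsqcup_{p\in M}\mathcal{N}_p\setminus\{\mathbf{0}_p\}$ with projection $\pi(p,v)=p$. $\mathsf{Sec}(\mathcal{N}M)$ denotes the set of its smooth global sections, i.e. the nowhere vanishing smooth null vector fields on $M$. A semiheap is a non-empty set $H$ with a ternary operation $(a,b,c) \mapsto [a,b,c] \in H$ satisfying the para-associative law $$\big[[a,b,c],d,e\big] = \big[a,[d,c,b],e\big] = \big[a,b,[c,d,e]\big]$$ for all $a,b,c,d,e \in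 H$. A partial semiheap is a non-empty set $H$ with a partially defined ternary operation, with values in $H$ whenever it is defined, that is para-associative: the equalities $\big[[a,b,c],d,e\big] = \big[a,[d,c,b],e\big] = \big[a,b,[c,d,e]\big]$ hold for $a,b,c,d,e\in H$ whenever the products involved are defined. *)

theory Defs
  imports "HOL-Analysis.Analysis" "HOL-Library.Function_Algebras"
begin

section \<open>Functions as a real vector space\<close>

instantiation "fun" :: (type, real_vector) real_vector
begin

definition scaleR_fun :: "real \<Rightarrow> ('a \<Rightarrow> 'b) \<Rightarrow> 'a \<Rightarrow> 'b"
  where "scaleR_fun c f = (\<lambda>x. c *\<^sub>R f x)"

instance
  by standard (simp_all add: scaleR_fun_def fun_eq_iff scaleR_add_right scaleR_add_left)

end

lemma scaleR_fun_apply [simp]: "(c *\<^sub>R f) x = c *\<^sub>R f x"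
  by (simp add: scaleR_fun_def)

text \<open>A family \<open>e\<close>, without repetitions, is a basis of the subspace \<open>S\<close>.\<close>

definition basis_of :: "'v::real_vector set \<Rightarrow> ('i \<Rightarrow> 'v) \<Rightarrow> bool"
  where "basis_of S e \<longleftrightarrow> inj e \<and> independent (range e) \<and> span (range e) = S"

definition proportional :: "'v::real_vector \<Rightarrow> 'v \<Rightarrow> bool"
  where "proportional v w \<longleftrightarrow> (\<exists>c::real. v = c *\<^sub>R w \<or> w = c *\<^sub>R v)"


section \<open>Smooth maps between Euclidean spaces\<close>

text \<open>Both notions are only meant for open \<open>S\<close>. A map is of class \<open>C\<^sup>n\<^sup>+\<^sup>1\<close> iff it is
  (Frechet) differentiable and all its directional derivatives are of class \<open>C\<^sup>n\<close>.\<close>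

fun Ck_on :: "nat \<Rightarrow> 'a::euclidean_space set \<Rightarrow> ('a \<Rightarrow> 'b::euclidean_space) \<Rightarrow> bool"
  where
    "Ck_on 0 S f \<longleftrightarrow> continuous_on S f"
  | "Ck_on (Suc n) S f \<longleftrightarrow>
      (\<forall>x\<in>S. f differentiable (at x)) \<and>
      (\<forall>v. Ck_on n S (\<lambda>x. frechet_derivative f (at x) v))"

definition smooth_on :: "'a::euclidean_space set \<Rightarrow> ('a \<Rightarrow> 'b::euclidean_space) \<Rightarrow> bool"
  where "smooth_on S f \<longleftrightarrow> (\<forall>n. Ck_on n S f)"


section \<open>Smooth manifolds\<close>

text \<open>A chart is a pair of its domain \<open>U\<close> and a coordinate map \<open>\<phi>\<close>, whose values outside \<open>U\<close> are
  irrelevant; on \<open>\<phi> ` U\<close> its inverse is \<open>inv_into U \<phi>\<close>.\<close>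

type_synonym ('a, 'e) chart = "'a set \<times> ('a \<Rightarrow> 'e)"

definition is_chart :: "'a topology \<Rightarrow> ('a, 'e::euclidean_space) chart \<Rightarrow> bool"
  where "is_chart X = (\<lambda>(U, \<phi>). openin X U \<and> open (\<phi> ` U) \<and>
           homeomorphic_map (subtopology X U) (top_of_set (\<phi> ` U)) \<phi>)"

definition smoothly_compatible ::
    "('a, 'e::euclidean_space) chart \<Rightarrow> ('a, 'e) chart \<Rightarrow> bool"
  where "smoothly_compatible = (\<lambda>(U, \<phi>) (V, \<psi>). smooth_on (\<phi> ` (U \<inter> V)) (\<psi> \<circ> inv_into U \<phi>))"

text \<open>The smooth structure is given by an arbitrary (not necessarily maximal) smooth atlas.\<close>

definition smooth_manifold :: "'a topology \<Rightarrow> ('a, 'e::euclidean_space) chart set \<Rightarrow> bool"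
  where "smooth_manifold X A \<longleftrightarrow>
    Hausdorff_space X \<and> second_countable X \<and>
    (\<forall>c\<in>A. is_chart X c) \<and>
    (\<Union>c\<in>A. fst c) = topspace X \<and>
    (\<forall>c\<in>A. \<forall>d\<in>A. smoothly_compatible c d)"

text \<open>The algebra of smooth real functions on the manifold. Since the carrier \<open>topspace X\<close> need not
  be the whole type, functions are normalised to vanish off it, so that equality of functions is
  equality on the manifold. The same convention is used for vector fields below.\<close>

definition smooth_functions ::
    "'a topology \<Rightarrow> ('a, 'e::euclidean_space) chart set \<Rightarrow> ('a \<Rightarrow> real) set"
  where "smooth_functions X A =
    {f. (\<forall>(U, \<phi>)\<in>A. smooth_on (\<phi> ` U) (f \<circ> inv_into U \<phi>)) \<and>
        (\<forall>p. p \<notin> topspace X \<longrightarrow> f p = 0)}"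

text \<open>Tangent vectors at \<open>p\<close> are the derivations at \<open>p\<close> of the algebra of smooth functions,
  normalised to be \<open>0\<close> on functions that are not smooth.\<close>

type_synonym 'a tangent_vector = "('a \<Rightarrow> real) \<Rightarrow> real"

definition tangent_space ::
    "'a topology \<Rightarrow> ('a, 'e::euclidean_space) chart set \<Rightarrow> 'a \<Rightarrow> 'a tangent_vector set"
  where "tangent_space X A p =
    {v. (\<forall>f\<in>smooth_functions X A. \<forall>h\<in>smooth_functions X A. v (f + h) = v f + v h) \<and>
        (\<forall>c::real. \<forall>f\<in>smooth_functions X A. v (c *\<^sub>R f) = c * v f) \<and>
        (\<forall>f\<in>smooth_functions X A. \<forall>h\<in>smooth_functions X A. v (f * h) = f p * v h + h p * v f) \<and>
        (\<forall>f. f \<notin> smooth_functions X A \<longrightarrow> v f = 0)}"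

text \<open>A vector field \<open>V\<close>, with value \<open>V p\<close> at \<open>p\<close>, is smooth iff the function
  \<open>V f = (\<lambda>p. V p f)\<close> is smooth for every smooth function \<open>f\<close> (as in O'Neill, Semi-Riemannian
  Geometry).\<close>

type_synonym 'a vector_field = "'a \<Rightarrow> 'a tangent_vector"

definition smooth_vector_fields ::
    "'a topology \<Rightarrow> ('a, 'e::euclidean_space) chart set \<Rightarrow> 'a vector_field set"
  where "smooth_vector_fields X A =
    {V. (\<forall>p\<in>topspace X. V p \<in> tangent_space X A p) \<and>
        (\<forall>f\<in>smooth_functions X A. (\<lambda>p. V p f) \<in> smooth_functions X A) \<and>
        (\<forall>p. p \<notin> topspace X \<longrightarrow> V p = 0)}"

definition global_frame ::
    "'a topology \<Rightarrow> ('a, 'e::euclidean_space) chart set \<Rightarrow> ('i \<Rightarrow> 'a vector_field) \<Rightarrow> bool"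
  where "global_frame X A e \<longleftrightarrow>
    (\<forall>i. e i \<in> smooth_vector_fields X A) \<and>
    (\<forall>p\<in>topspace X. basis_of (tangent_space X A p) (\<lambda>i. e i p))"


section \<open>Spacetimes\<close>

type_synonym 'a metric_field = "'a \<Rightarrow> 'a tangent_vector \<Rightarrow> 'a tangent_vector \<Rightarrow> real"

text \<open>The type \<open>4\<close> of indices has elements \<open>0, 1, 2, 3\<close>; the index \<open>0\<close> is the negative direction.\<close>

definition minkowski :: "4 \<Rightarrow> 4 \<Rightarrow> real"
  where "minkowski i j = (if i \<noteq> j then 0 else if i = 0 then -1 else 1)"

text \<open>Smoothness of a metric means that it maps pairs of smooth vector fields to smooth functions.
  Signature \<open>(-,+,+,+)\<close> at a point means that there is a basis of the tangent space in
  which the metric is the diagonal matrix \<open>(-1,1,1,1)\<close>.\<close>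

definition lorentzian_metric ::
    "'a topology \<Rightarrow> ('a, real^4) chart set \<Rightarrow> 'a metric_field \<Rightarrow> bool"
  where "lorentzian_metric X A g \<longleftrightarrow>
    (\<forall>p\<in>topspace X.
      (\<forall>u\<in>tangent_space X A p. \<forall>v\<in>tangent_space X A p. g p u v = g p v u) \<and>
      (\<forall>u\<in>tangent_space X A p. \<forall>v\<in>tangent_space X A p. \<forall>w\<in>tangent_space X A p.
         g p (u + v) w = g p u w + g p v w) \<and>
      (\<forall>c::real. \<forall>u\<in>tangent_space X A p. \<forall>v\<in>tangent_space X A p.
         g p (c *\<^sub>R u) v = c * g p u v) \<and>
      (\<exists>b. basis_of (tangent_space X A p) b \<and> (\<forall>i j. g p (b i) (b j) = minkowski i j))) \<and>
    (\<forall>V\<in>smooth_vector_fields X A. \<forall>W\<in>smooth_vector_fields X A.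
      (\<lambda>p. if p \<in> topspace X then g p (V p) (W p) else 0) \<in> smooth_functions X A)"

definition spacetime ::
    "'a topology \<Rightarrow> ('a, real^4) chart set \<Rightarrow> 'a metric_field \<Rightarrow> 'a vector_field \<Rightarrow> bool"
  where "spacetime X A g \<tau> \<longleftrightarrow>
    smooth_manifold X A \<and> connected_space X \<and> lorentzian_metric X A g \<and>
    \<tau> \<in> smooth_vector_fields X A \<and> (\<forall>p\<in>topspace X. g p (\<tau> p) (\<tau> p) < 0)"

definition parallelizable :: "'a topology \<Rightarrow> ('a, real^4) chart set \<Rightarrow> bool"
  where "parallelizable X A \<longleftrightarrow> (\<exists>e :: 4 \<Rightarrow> 'a vector_field. global_frame X A e)"

definition null_vectors ::
    "'a topology \<Rightarrow> ('a, real^4) chart set \<Rightarrow> 'a metric_field \<Rightarrow> 'a \<Rightarrow> 'a tangent_vector set"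
  where "null_vectors X A g p = {v \<in> tangent_space X A p. g p v v = 0}"

definition null_tangent_bundle ::
    "'a topology \<Rightarrow> ('a, real^4) chart set \<Rightarrow> 'a metric_field \<Rightarrow> ('a \<times> 'a tangent_vector) set"
  where "null_tangent_bundle X A g = (SIGMA p : topspace X. null_vectors X A g p - {0})"

text \<open>A section \<open>p \<mapsto> (p, u p)\<close> of the null tangent bundle is represented by the vector field \<open>u\<close>.\<close>

definition null_sections ::
    "'a topology \<Rightarrow> ('a, real^4) chart set \<Rightarrow> 'a metric_field \<Rightarrow> 'a vector_field set"
  where "null_sections X A g =
    {u \<in> smooth_vector_fields X A. \<forall>p\<in>topspace X. (p, u p) \<in> null_tangent_bundle X A g}"


section \<open>Partial semiheaps\<close>

text \<open>A partial operation is an \<open>option\<close>-valued one; an iterated product is defined iff both the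
  inner and the outer product are. Each of the equalities between the three bracketings is required
  as soon as its two sides are defined.\<close>

definition partial_semiheap :: "'h set \<Rightarrow> ('h \<Rightarrow> 'h \<Rightarrow> 'h \<Rightarrow> 'h option) \<Rightarrow> bool"
  where "partial_semiheap H t \<longleftrightarrow>
    H \<noteq> {} \<and>
    (\<forall>a\<in>H. \<forall>b\<in>H. \<forall>c\<in>H. \<forall>x. t a b c = Some x \<longrightarrow> x \<in> H) \<and>
    (\<forall>a\<in>H. \<forall>b\<in>H. \<forall>c\<in>H. \<forall>d\<in>H. \<forall>e\<in>H.
      let l = Option.bind (t a b c) (\<lambda>x. t x d e);
          m = Option.bind (t d c b) (\<lambda>x. t a x e);
          r = Option.bind (t c d e) (\<lambda>x. t a b x)
      in (l \<noteq> None \<and> m \<noteq> None \<longrightarrow> l = m) \<and>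
         (m \<noteq> None \<and> r \<noteq> None \<longrightarrow> m = r) \<and>
         (l \<noteq> None \<and> r \<noteq> None \<longrightarrow> l = r))"

definition null_product ::
    "'a topology \<Rightarrow> 'a metric_field \<Rightarrow> 'a vector_field \<Rightarrow> 'a vector_field \<Rightarrow> 'a vector_field
      \<Rightarrow> 'a vector_field option"
  where "null_product X g u v w =
    (if \<forall>p\<in>topspace X. \<not> proportional (v p) (w p)
     then Some (\<lambda>p. g p (v p) (w p) *\<^sub>R u p)
     else None)"

end

theory Submission
  imports Defs
begin

text \<open>Para-associativity is a pointwise computation: each of the three bracketings, where defined,
  equals \<open>a g(b,c) g(d,e)\<close>. The two points with content are that the product of null sections
  is again a null section, and that there is a null section at all.

  For the first, \<open>g(v,w)\<close> must not vanish when the null vectors \<open>v\<close> and \<open>w\<close> are not proportional.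
  This follows from the fact that the orthogonal complement of a timelike vector \<open>t\<close> is positive
  definite (\<open>pos_of_orthogonal_timelike\<close>): if \<open>v\<close> and \<open>w\<close> were orthogonal, then
  the combination \<open>z = g(w,t) v - g(v,t) w\<close> would be null and orthogonal to \<open>t\<close>, hence zero.

  For the second, let \<open>e\<^sub>0, ..., e\<^sub>3\<close> be a global frame and \<open>c\<^sub>i = g(\<tau>, e\<^sub>i)\<close>. The field
  \<open>Y = - c\<^sub>1 e\<^sub>0 + c\<^sub>0 e\<^sub>1 - c\<^sub>3 e\<^sub>2 + c\<^sub>2 e\<^sub>3\<close> arises from \<open>c\<close> by an invertible antisymmetric matrix.
  Antisymmetry makes it orthogonal to \<open>\<tau>\<close>, and invertibility makes it nowhere zero, because
  \<open>c\<close> is nowhere zero. (This is where the even dimension of the spacetime enters; behind it is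
  the nowhere vanishing tangent field on the 3-sphere.) So \<open>Y\<close> is spacelike, and
  \<open>sqrt (g(Y,Y)) \<tau> + sqrt (- g(\<tau>,\<tau>)) Y\<close> is null and nowhere zero. It is smooth because smooth
  functions are closed under sums, products and square roots of positive functions.\<close>

section \<open>Calculus of maps of class \<open>C\<^sup>k\<close>\<close>

lemma Ck_on_cong:
  assumes "open S" "Ck_on n S f" "\<And>x. x \<in> S \<Longrightarrow> f x = h x"
  shows "Ck_on n S h"
  using assms(2,3)
proof (induction n arbitrary: f h)
  case 0
  then show ?case by (simp cong: continuous_on_cong)
next
  case (Suc n)
  have D: "(h has_derivative frechet_derivative f (at x)) (at x)" if "x \<in> S" for x
  proof (rule has_derivative_transform_within_open[OF _ assms(1) that])
    show "(f has_derivative frechet_derivative f (at x)) (at x)"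
      using Suc.prems(1) that by (simp add: frechet_derivative_works)
  qed (use Suc.prems(2) in auto)
  have "Ck_on n S (\<lambda>x. frechet_derivative h (at x) v)" for v
  proof (rule Suc.IH)
    show "Ck_on n S (\<lambda>x. frechet_derivative f (at x) v)"
      using Suc.prems(1) by simp
  next
    fix x assume "x \<in> S"
    then show "frechet_derivative f (at x) v = frechet_derivative h (at x) v"
      using frechet_derivative_at[OF D] by simp
  qed
  then show ?case
    using D by (auto simp: differentiable_def)
qed

text \<open>This form of the successor step spares the computation of \<open>frechet_derivative\<close>: any
  explicitly known derivative will do.\<close>

lemma Ck_on_SucI:
  assumes "open S" "\<And>x. x \<in> S \<Longrightarrow> (f has_derivative f' x) (at x)"
    and "\<And>v. Ck_on n S (\<lambda>x. f' x v)"
  shows "Ck_on (Suc n) S f"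
proof -
  have "Ck_on n S (\<lambda>x. frechet_derivative f (at x) v)" for v
    by (rule Ck_on_cong[OF assms(1) assms(3)[of v]])
      (use frechet_derivative_at[OF assms(2)] in simp)
  then show ?thesis
    using assms(2) by (auto simp: differentiable_def)
qed

lemma Ck_on_SucD:
  assumes "Ck_on (Suc n) S f"
  shows "x \<in> S \<Longrightarrow> (f has_derivative frechet_derivative f (at x)) (at x)"
    and "Ck_on n S (\<lambda>x. frechet_derivative f (at x) v)"
  using assms by (auto simp: frechet_derivative_works)

lemma Ck_on_Suc_imp:
  "Ck_on (Suc n) S f \<Longrightarrow> Ck_on n S f"
proof (induction n arbitrary: f)
  case 0
  then show ?case
    by (auto intro!: continuous_at_imp_continuous_on differentiable_imp_continuous_within)
next
  case (Suc n)
  from Suc.prems have "Ck_on (Suc n) S (\<lambda>x. frechet_derivative f (at x) v)" for v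
    by (rule Ck_on_SucD(2))
  with Suc show ?case by simp
qed

lemma Ck_on_const: "Ck_on n S (\<lambda>x. c)"
proof (induction n arbitrary: c)
  case (Suc n)
  then show ?case by simp
qed simp

lemma Ck_on_add:
  assumes "open S" "Ck_on n S f" "Ck_on n S h"
  shows "Ck_on n S (\<lambda>x. f x + h x)"
  using assms(2,3)
proof (induction n arbitrary: f h)
  case 0
  then show ?case by (simp add: continuous_on_add)
next
  case (Suc n)
  show ?case
  proof (rule Ck_on_SucI[OF assms(1)])
    fix x assume "x \<in> S"
    then show "((\<lambda>x. f x + h x) has_derivative
        (\<lambda>v. frechet_derivative f (at x) v + frechet_derivative h (at x) v)) (at x)"
      using Suc.prems by (intro has_derivative_add Ck_on_SucD(1))
  next
    fix v
    show "Ck_on n S (\<lambda>x. frechet_derivative f (at x) v + frechet_derivative h (at x) v)"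
      using Suc.prems by (intro Suc.IH Ck_on_SucD(2))
  qed
qed

lemma Ck_on_mult:
  fixes f h :: "'a::euclidean_space \<Rightarrow> real"
  assumes "open S" "Ck_on n S f" "Ck_on n S h"
  shows "Ck_on n S (\<lambda>x. f x * h x)"
  using assms(2,3)
proof (induction n arbitrary: f h)
  case 0
  then show ?case by (simp add: continuous_on_mult)
next
  case (Suc n)
  show ?case
  proof (rule Ck_on_SucI[OF assms(1)])
    fix x assume "x \<in> S"
    then show "((\<lambda>x. f x * h x) has_derivative
        (\<lambda>v. f x * frechet_derivative h (at x) v + frechet_derivative f (at x) v * h x)) (at x)"
      using Suc.prems by (intro has_derivative_mult Ck_on_SucD(1))
  next
    fix v
    show "Ck_on n S (\<lambda>x. f x * frechet_derivative h (at x) v + frechet_derivative f (at x) v * h x)"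
      using Suc.prems by (intro Ck_on_add[OF assms(1)] Suc.IH Ck_on_SucD(2))
        (auto intro: Ck_on_Suc_imp simp del: Ck_on.simps)
  qed
qed

text \<open>Square roots alone would not support the induction, since differentiating a square root
  introduces its reciprocal; the powers with arbitrary real exponent are closed under
  differentiation.\<close>

lemma Ck_on_powr:
  fixes f :: "'a::euclidean_space \<Rightarrow> real"
  assumes "open S" "Ck_on n S f" "\<And>x. x \<in> S \<Longrightarrow> 0 < f x"
  shows "Ck_on n S (\<lambda>x. f x powr a)"
  using assms(2)
proof (induction n arbitrary: a)
  case 0
  then show ?case using assms(3)
    by (auto intro!: continuous_on_powr continuous_on_const simp: less_imp_neq)
      (metis less_irrefl)
next
  case (Suc n)
  show ?case
  proof (rule Ck_on_SucI[OF assms(1)])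
    fix x assume x: "x \<in> S"
    show "((\<lambda>x. f x powr a) has_derivative
        (\<lambda>v. frechet_derivative f (at x) v * (a * f x powr (a - 1)))) (at x)"
      by (rule DERIV_compose_FDERIV[OF has_real_derivative_powr[OF assms(3)[OF x]]
            Ck_on_SucD(1)[OF Suc.prems x]])
  next
    fix v
    show "Ck_on n S (\<lambda>x. frechet_derivative f (at x) v * (a * f x powr (a - 1)))"
      by (intro Ck_on_mult[OF assms(1)] Ck_on_const Suc.IH Ck_on_SucD(2)[OF Suc.prems]
            Ck_on_Suc_imp[OF Suc.prems])
  qed
qed


section \<open>Smooth functions and vector fields on a manifold\<close>

lemma smooth_functionsD:
  assumes "f \<in> smooth_functions X A"
  shows "(U, \<phi>) \<in> A \<Longrightarrow> Ck_on n (\<phi> ` U) (\<lambda>x. f (inv_into U \<phi> x))"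
    and "p \<notin> topspace X \<Longrightarrow> f p = 0"
  using assms by (auto simp: smooth_functions_def smooth_on_def o_def)

lemma smooth_functionsI:
  assumes "\<And>U \<phi> n. (U, \<phi>) \<in> A \<Longrightarrow> Ck_on n (\<phi> ` U) (\<lambda>x. f (inv_into U \<phi> x))"
    and "\<And>p. p \<notin> topspace X \<Longrightarrow> f p = 0"
  shows "f \<in> smooth_functions X A"
  using assms by (auto simp: smooth_functions_def smooth_on_def o_def)

lemma smooth_manifold_chart:
  assumes "smooth_manifold X A" "(U, \<phi>) \<in> A"
  shows "open (\<phi> ` U)" and "U \<subseteq> topspace X"
proof -
  have "is_chart X (U, \<phi>)"
    using assms by (simp add: smooth_manifold_def)
  then show "open (\<phi> ` U)" "U \<subseteq> topspace X"
    by (auto simp: is_chart_def dest: openin_subset)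
qed

lemma smooth_functions_add:
  assumes "smooth_manifold X A" "f \<in> smooth_functions X A" "h \<in> smooth_functions X A"
  shows "(\<lambda>p. f p + h p) \<in> smooth_functions X A"
proof (rule smooth_functionsI)
  fix U \<phi> n assume c: "(U, \<phi>) \<in> A"
  show "Ck_on n (\<phi> ` U) (\<lambda>x. f (inv_into U \<phi> x) + h (inv_into U \<phi> x))"
    by (intro Ck_on_add smooth_manifold_chart(1)[OF assms(1) c] smooth_functionsD(1)[OF assms(2) c]
          smooth_functionsD(1)[OF assms(3) c])
qed (use assms in \<open>simp add: smooth_functionsD(2)\<close>)

lemma smooth_functions_mult:
  assumes "smooth_manifold X A" "f \<in> smooth_functions X A" "h \<in> smooth_functions X A"
  shows "(\<lambda>p. f p * h p) \<in> smooth_functions X A"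
proof (rule smooth_functionsI)
  fix U \<phi> n assume c: "(U, \<phi>) \<in> A"
  show "Ck_on n (\<phi> ` U) (\<lambda>x. f (inv_into U \<phi> x) * h (inv_into U \<phi> x))"
    by (intro Ck_on_mult smooth_manifold_chart(1)[OF assms(1) c] smooth_functionsD(1)[OF assms(2) c]
          smooth_functionsD(1)[OF assms(3) c])
qed (use assms in \<open>simp add: smooth_functionsD(2)\<close>)

lemma smooth_functions_uminus:
  assumes "smooth_manifold X A" "f \<in> smooth_functions X A"
  shows "(\<lambda>p. - f p) \<in> smooth_functions X A"
proof (rule smooth_functionsI)
  fix U \<phi> n assume c: "(U, \<phi>) \<in> A"
  have "Ck_on n (\<phi> ` U) (\<lambda>x. - 1 * f (inv_into U \<phi> x))"
    by (intro Ck_on_mult Ck_on_const smooth_manifold_chart(1)[OF assms(1) c]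
          smooth_functionsD(1)[OF assms(2) c])
  then show "Ck_on n (\<phi> ` U) (\<lambda>x. - f (inv_into U \<phi> x))"
    by simp
qed (use assms in \<open>simp add: smooth_functionsD(2)\<close>)

lemma smooth_functions_sqrt:
  assumes M: "smooth_manifold X A" and f: "f \<in> smooth_functions X A"
    and pos: "\<And>p. p \<in> topspace X \<Longrightarrow> 0 < f p"
  shows "(\<lambda>p. sqrt (f p)) \<in> smooth_functions X A"
proof (rule smooth_functionsI)
  fix U \<phi> n assume c: "(U, \<phi>) \<in> A"
  have pos': "0 < f (inv_into U \<phi> x)" if "x \<in> \<phi> ` U" for x
    using pos smooth_manifold_chart(2)[OF M c] inv_into_into[OF that] by auto
  have "Ck_on n (\<phi> ` U) (\<lambda>x. f (inv_into U \<phi> x) powr (1/2))"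
    by (intro Ck_on_powr pos' smooth_manifold_chart(1)[OF M c] smooth_functionsD(1)[OF f c])
  then show "Ck_on n (\<phi> ` U) (\<lambda>x. sqrt (f (inv_into U \<phi> x)))"
    by (rule Ck_on_cong[OF smooth_manifold_chart(1)[OF M c]])
      (use pos' in \<open>simp add: powr_half_sqrt less_imp_le\<close>)
qed (use f in \<open>simp add: smooth_functionsD(2)\<close>)

lemma subspace_tangent_space: "subspace (tangent_space X A p)"
  unfolding subspace_def tangent_space_def
  by (auto simp: algebra_simps)

lemma smooth_vector_fieldsD:
  assumes "V \<in> smooth_vector_fields X A"
  shows "p \<in> topspace X \<Longrightarrow> V p \<in> tangent_space X A p"
    and "p \<notin> topspace X \<Longrightarrow> V p = 0"
    and "f \<in> smooth_functions X A \<Longrightarrow> (\<lambda>p. V p f) \<in> smooth_functions X A"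
  using assms by (auto simp: smooth_vector_fields_def)

lemma smooth_vector_fields_add:
  assumes "smooth_manifold X A" "V \<in> smooth_vector_fields X A" "W \<in> smooth_vector_fields X A"
  shows "(\<lambda>p. V p + W p) \<in> smooth_vector_fields X A"
  using assms smooth_functions_add[OF assms(1)]
  by (simp add: smooth_vector_fields_def subspace_add[OF subspace_tangent_space])

lemma smooth_vector_fields_scale:
  assumes "smooth_manifold X A" "h \<in> smooth_functions X A" "V \<in> smooth_vector_fields X A"
  shows "(\<lambda>p. h p *\<^sub>R V p) \<in> smooth_vector_fields X A"
  using assms smooth_functions_mult[OF assms(1,2)]
  by (simp add: smooth_vector_fields_def subspace_scale[OF subspace_tangent_space])


section \<open>Linear algebra of Lorentzian forms\<close>

lemma basis_of_coordinates:
  fixes e :: "'i::finite \<Rightarrow> 'v::real_vector"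
  assumes "basis_of S e" "v \<in> S"
  obtains x where "v = (\<Sum>i\<in>UNIV. x i *\<^sub>R e i)"
proof -
  from assms have inj: "inj e" and "v \<in> span (range e)"
    by (auto simp: basis_of_def)
  then obtain u where "v = (\<Sum>w\<in>range e. u w *\<^sub>R w)"
    by (auto simp: span_finite)
  also have "\<dots> = (\<Sum>i\<in>UNIV. u (e i) *\<^sub>R e i)"
    using inj by (simp add: sum.reindex)
  finally show thesis
    by (rule that)
qed

lemma basis_of_sum_eq_0:
  fixes e :: "'i::finite \<Rightarrow> 'v::real_vector"
  assumes "basis_of S e" "(\<Sum>i\<in>UNIV. x i *\<^sub>R e i) = 0"
  shows "x i = 0"
proof -
  from assms have inj: "inj e" and ind: "independent (range e)"
    by (auto simp: basis_of_def)
  have "(\<Sum>w\<in>range e. x (inv e w) *\<^sub>R w) = 0"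
    using inj assms(2) by (simp add: sum.reindex)
  then have "x (inv e (e i)) = 0"
    by (intro independentD[OF ind _ order_refl]) auto
  then show ?thesis
    using inj by simp
qed

lemma basis_of_mem: "basis_of S e \<Longrightarrow> e i \<in> S"
  by (auto simp: basis_of_def intro: span_base)

locale lorentzian_space =
  fixes S :: "'v::real_vector set" and B :: "'v \<Rightarrow> 'v \<Rightarrow> real"
  assumes subspace: "subspace S"
    and sym: "u \<in> S \<Longrightarrow> v \<in> S \<Longrightarrow> B u v = B v u"
    and add_left: "u \<in> S \<Longrightarrow> v \<in> S \<Longrightarrow> w \<in> S \<Longrightarrow> B (u + v) w = B u w + B v w"
    and scale_left: "u \<in> S \<Longrightarrow> v \<in> S \<Longrightarrow> B (c *\<^sub>R u) v = c * B u v"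
    and orthonormal_basis: "\<exists>b. basis_of S b \<and> (\<forall>i j. B (b i) (b j) = minkowski i j)"
begin

lemma add_right: "u \<in> S \<Longrightarrow> v \<in> S \<Longrightarrow> w \<in> S \<Longrightarrow> B w (u + v) = B w u + B w v"
  by (metis add_left subspace subspace_add sym)

lemma scale_right: "u \<in> S \<Longrightarrow> v \<in> S \<Longrightarrow> B v (c *\<^sub>R u) = c * B v u"
  by (metis scale_left subspace subspace_scale sym)

lemma zero_left: "u \<in> S \<Longrightarrow> B 0 u = 0"
  using scale_left[of u u 0] by simp

lemma sum_left:
  assumes "finite I" "\<And>i. i \<in> I \<Longrightarrow> e i \<in> S" "w \<in> S"
  shows "B (\<Sum>i\<in>I. x i *\<^sub>R e i) w = (\<Sum>i\<in>I. x i * B (e i) w)"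
  using assms
proof (induction I rule: finite_induct)
  case empty
  then show ?case by (simp add: zero_left)
next
  case (insert i I)
  then have "(\<Sum>i\<in>I. x i *\<^sub>R e i) \<in> S"
    by (intro subspace_sum[OF subspace] subspace_scale[OF subspace]) auto
  with insert show ?case
    by (simp add: add_left scale_left subspace_scale[OF subspace])
qed

lemma orthonormal_expansion:
  assumes b: "basis_of S b" "\<And>i j. B (b i) (b j) = minkowski i j"
  shows "B (\<Sum>i\<in>UNIV. x i *\<^sub>R b i) (\<Sum>i\<in>UNIV. y i *\<^sub>R b i)
    = (\<Sum>i\<in>-{0}. x i * y i) - x 0 * y 0"
proof -
  note mem = basis_of_mem[OF b(1)]
  let ?y = "\<Sum>i\<in>UNIV. y i *\<^sub>R b i"
  have y: "?y \<in> S"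
    by (intro subspace_sum[OF subspace] subspace_scale[OF subspace] mem)
  have "B (b i) ?y = y i * minkowski i i" for i
  proof -
    have "B (b i) ?y = B ?y (b i)"
      by (rule sym[OF mem y])
    also have "\<dots> = (\<Sum>j\<in>UNIV. y j * minkowski j i)"
      using sum_left[of UNIV b "b i" y] mem b(2) by simp
    also have "\<dots> = (\<Sum>j\<in>UNIV. if j = i then y i * minkowski i i else 0)"
      by (rule sum.cong) (auto simp: minkowski_def)
    finally show ?thesis by simp
  qed
  then have "B (\<Sum>i\<in>UNIV. x i *\<^sub>R b i) ?y = (\<Sum>i\<in>UNIV. x i * (y i * minkowski i i))"
    using sum_left[of UNIV b ?y x] mem y by simp
  also have "\<dots> = x 0 * (y 0 * minkowski 0 0) + (\<Sum>i\<in>-{0}. x i * (y i * minkowski i i))"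
    using sum.remove[of "UNIV :: 4 set" 0] by (simp add: Compl_eq_Diff_UNIV)
  also have "(\<Sum>i\<in>-{0}. x i * (y i * minkowski i i)) = (\<Sum>i\<in>-{0}. x i * y i)"
    by (rule sum.cong) (auto simp: minkowski_def)
  finally show ?thesis
    by (simp add: minkowski_def)
qed

lemma exists_timelike: "\<exists>t\<in>S. B t t < 0"
proof -
  from orthonormal_basis obtain b where b: "basis_of S b" "\<And>i j. B (b i) (b j) = minkowski i j"
    by auto
  have "B (b 0) (b 0) < 0"
    by (simp add: b(2) minkowski_def)
  with basis_of_mem[OF b(1)] show ?thesis by blast
qed

text \<open>In coordinates, \<open>|t'|\<^sup>2 < t\<^sub>0\<^sup>2\<close> and \<open>t\<^sub>0 v\<^sub>0 = t' \<bullet> v'\<close>, where the primes denote spatial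
  parts. By the Cauchy-Schwarz inequality \<open>t\<^sub>0\<^sup>2 v\<^sub>0\<^sup>2 \<le> |t'|\<^sup>2 |v'|\<^sup>2\<close>, which forces \<open>v\<^sub>0\<^sup>2 < |v'|\<^sup>2\<close>
  unless \<open>v = 0\<close>.\<close>

lemma pos_of_orthogonal_timelike:
  assumes t: "t \<in> S" "B t t < 0" and v: "v \<in> S" "B t v = 0" "v \<noteq> 0"
  shows "0 < B v v"
proof -
  from orthonormal_basis obtain b where b: "basis_of S b" "\<And>i j. B (b i) (b j) = minkowski i j"
    by auto
  obtain y where y: "t = (\<Sum>i\<in>UNIV. y i *\<^sub>R b i)"
    using basis_of_coordinates[OF b(1) t(1)] .
  obtain x where x: "v = (\<Sum>i\<in>UNIV. x i *\<^sub>R b i)"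
    using basis_of_coordinates[OF b(1) v(1)] .
  note expand = orthonormal_expansion[OF b]
  define P where "P = (\<Sum>i\<in>-{0}. (y i)\<^sup>2)"
  define Q where "Q = (\<Sum>i\<in>-{0}. (x i)\<^sup>2)"
  have tt: "P < (y 0)\<^sup>2"
    using t(2) by (simp add: y expand P_def power2_eq_square)
  have "(\<Sum>i\<in>-{0}. y i * x i) = y 0 * x 0"
    using v(2) by (simp add: y x expand)
  then have CS: "(y 0)\<^sup>2 * (x 0)\<^sup>2 \<le> P * Q"
    using Cauchy_Schwarz_ineq_sum[of y x "-{0}"] by (simp add: P_def Q_def power_mult_distrib)
  have P: "0 \<le> P" and Q: "0 \<le> Q"
    by (auto simp: P_def Q_def intro: sum_nonneg)
  have "Q \<noteq> 0"
  proof
    assume Q0: "Q = 0"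
    with CS tt P have "x 0 = 0"
      by (auto simp: mult_le_0_iff)
    moreover have "x i = 0" if "i \<noteq> 0" for i
      using Q0 that by (auto simp: Q_def sum_nonneg_eq_0_iff)
    ultimately have "x i = 0" for i by (cases "i = 0") auto
    with v(3) show False by (simp add: x)
  qed
  with Q have "0 < Q" by simp
  with tt have "P * Q < (y 0)\<^sup>2 * Q" by simp
  with CS have "(y 0)\<^sup>2 * (x 0)\<^sup>2 < (y 0)\<^sup>2 * Q" by linarith
  then have "(x 0)\<^sup>2 < Q"
    by (simp add: mult_less_cancel_left)
  then show ?thesis
    by (simp add: x expand Q_def power2_eq_square)
qed

lemma orthogonal_null_imp_proportional:
  assumes v: "v \<in> S" "B v v = 0" and w: "w \<in> S" "B w w = 0" and "B v w = 0"
  shows "proportional v w"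
proof -
  obtain t where t: "t \<in> S" "B t t < 0"
    using exists_timelike by blast
  define z where "z = B t w *\<^sub>R v + (- B t v) *\<^sub>R w"
  note bilinear = add_left add_right scale_left scale_right
  note closed = subspace_add[OF subspace] subspace_scale[OF subspace]
  have z: "z \<in> S"
    unfolding z_def by (intro closed v w)
  have "B z z = 0"
    unfolding z_def using v w assms(5) sym[of w v]
    by (simp add: bilinear closed del: scaleR_minus_left)
  moreover have "B t z = 0"
    unfolding z_def using v w t by (simp add: bilinear closed del: scaleR_minus_left)
  ultimately have "z = 0"
    using pos_of_orthogonal_timelike[OF t z] by auto
  then have eq: "B t w *\<^sub>R v = B t v *\<^sub>R w"
    by (simp add: z_def)
  show ?thesis
  proof (cases "B t w = 0")
    case True
    then have "w = 0"
      using pos_of_orthogonal_timelike[OF t w(1)] w(2) by auto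
    then have "w = 0 *\<^sub>R v" by simp
    then show ?thesis unfolding proportional_def by blast
  next
    case False
    then have "v = (1 / B t w) *\<^sub>R (B t w *\<^sub>R v)" by simp
    also have "\<dots> = (B t v / B t w) *\<^sub>R w"
      unfolding eq by simp
    finally show ?thesis unfolding proportional_def by blast
  qed
qed

text \<open>The coefficients \<open>(- c\<^sub>1, c\<^sub>0, - c\<^sub>3, c\<^sub>2)\<close> are \<open>J c\<close> for an invertible antisymmetric matrix \<open>J\<close>,
  so \<open>B(Y,t) = (J c) \<bullet> c = 0\<close>, and \<open>Y = 0\<close> only if \<open>c = 0\<close>, that is if \<open>t\<close> is orthogonal to a basis
  and hence to itself.\<close>

lemma twisted_dual_spacelike:
  fixes e :: "4 \<Rightarrow> 'v"
  assumes e: "basis_of S e" and t: "t \<in> S" "B t t < 0"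
  defines "Y \<equiv> (- B t (e 1)) *\<^sub>R e 0 + B t (e 0) *\<^sub>R e 1 + (- B t (e 3)) *\<^sub>R e 2 + B t (e 2) *\<^sub>R e 3"
  shows "B t Y = 0" and "0 < B Y Y"
proof -
  note closed = subspace_add[OF subspace] subspace_scale[OF subspace] basis_of_mem[OF e]
  have Y: "Y \<in> S"
    unfolding Y_def by (intro closed)
  show orth: "B t Y = 0"
    unfolding Y_def using t(1)
    by (simp add: add_right scale_right closed del: scaleR_minus_left)
  have "Y \<noteq> 0"
  proof
    assume Y0: "Y = 0"
    define a :: "4 \<Rightarrow> real" where "a = (\<lambda>i. if i = 0 then - B t (e 1) else if i = 1 then B t (e 0)
      else if i = 2 then - B t (e 3) else B t (e 2))"
    \<comment> \<open>In the type \<open>4\<close> arithmetic is modulo 4, so that the index \<open>4\<close> of the sum is \<open>0\<close>.\<close>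
    have four: "(4::4) = 0" by simp
    have a: "a 0 = - B t (e 1)" "a 1 = B t (e 0)" "a 2 = - B t (e 3)" "a 3 = B t (e 2)"
      by (simp_all add: a_def)
    have "(\<Sum>i\<in>UNIV. a i *\<^sub>R e i) = Y"
      unfolding sum_4 four a Y_def by (simp add: algebra_simps)
    then have "a i = 0" for i
      using basis_of_sum_eq_0[OF e] Y0 by simp
    from this[of 0] this[of 1] this[of 2] this[of 3]
    have "B t (e 0) = 0" "B t (e 1) = 0" "B t (e 2) = 0" "B t (e 3) = 0"
      unfolding a by simp_all
    moreover have "i = 0 \<or> i = 1 \<or> i = 2 \<or> i = 3" for i :: 4
      using exhaust_4[of i] four by auto
    ultimately have c0: "B t (e i) = 0" for i
      by metis
    obtain x where x: "t = (\<Sum>i\<in>UNIV. x i *\<^sub>R e i)"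
      using basis_of_coordinates[OF e t(1)] .
    have "B (\<Sum>i\<in>UNIV. x i *\<^sub>R e i) t = (\<Sum>i\<in>UNIV. x i * B (e i) t)"
      by (rule sum_left) (auto intro: closed t)
    then have "B t t = 0"
      using c0 sym[OF t(1) basis_of_mem[OF e]] by (simp flip: x)
    with t(2) show False by simp
  qed
  then show "0 < B Y Y"
    by (rule pos_of_orthogonal_timelike[OF t Y orth])
qed

text \<open>The coefficients rescale \<open>t\<close> and \<open>y\<close> to have opposite squares \<open>- k\<close> and \<open>k\<close>, where
  \<open>k = - B(t,t) B(y,y)\<close>. The sum is nonzero because its product with \<open>t\<close> is.\<close>

lemma timelike_spacelike_null:
  assumes t: "t \<in> S" "B t t < 0" and y: "y \<in> S" "B t y = 0" "0 < B y y"
  defines "u \<equiv> sqrt (B y y) *\<^sub>R t + sqrt (- B t t) *\<^sub>R y"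
  shows "B u u = 0" and "u \<noteq> 0"
proof -
  note closed = subspace_add[OF subspace] subspace_scale[OF subspace]
  note bilinear = add_left add_right scale_left scale_right
  have yt: "B y t = 0" using y(2) sym[OF y(1) t(1)] by simp
  have "B u u = (sqrt (B y y))\<^sup>2 * B t t + (sqrt (- B t t))\<^sup>2 * B y y"
    unfolding u_def using t(1) y(1,2) yt
    by (simp add: bilinear closed power2_eq_square del: real_sqrt_mult_self)
  also have "\<dots> = 0"
    using t(2) y(3) by simp
  finally show "B u u = 0" .
  have "B u t = sqrt (B y y) * B t t"
    unfolding u_def using t(1) y(1) yt by (simp add: bilinear closed)
  then have "B u t \<noteq> 0"
    using t(2) y(3) by simp
  then show "u \<noteq> 0"
    using zero_left[OF t(1)] by auto
qed

end

lemma lorentzian_space_tangent_space: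
  assumes "lorentzian_metric X A g" "p \<in> topspace X"
  shows "lorentzian_space (tangent_space X A p) (g p)"
  using assms unfolding lorentzian_metric_def
  by unfold_locales (simp_all add: subspace_tangent_space)


section \<open>Null sections of a spacetime\<close>

lemma null_sectionsI:
  assumes "u \<in> smooth_vector_fields X A"
    and "\<And>p. p \<in> topspace X \<Longrightarrow> g p (u p) (u p) = 0" "\<And>p. p \<in> topspace X \<Longrightarrow> u p \<noteq> 0"
  shows "u \<in> null_sections X A g"
  using assms
  by (auto simp: null_sections_def null_tangent_bundle_def null_vectors_def smooth_vector_fieldsD)

lemma null_sectionsD:
  assumes "u \<in> null_sections X A g"
  shows "u \<in> smooth_vector_fields X A"
    and "p \<in> topspace X \<Longrightarrow> u p \<in> tangent_space X A p"
    and "p \<in> topspace X \<Longrightarrow> g p (u p) (u p) = 0"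
    and "p \<in> topspace X \<Longrightarrow> u p \<noteq> 0"
    and "p \<notin> topspace X \<Longrightarrow> u p = 0"
  using assms
  by (auto simp: null_sections_def null_tangent_bundle_def null_vectors_def smooth_vector_fieldsD)

text \<open>The function \<open>p \<mapsto> g p (V p) (W p)\<close> itself need not vanish off the manifold, where the metric
  field is arbitrary.\<close>

definition metric_product ::
    "'a topology \<Rightarrow> 'a metric_field \<Rightarrow> 'a vector_field \<Rightarrow> 'a vector_field \<Rightarrow> 'a \<Rightarrow> real"
  where "metric_product X g V W = (\<lambda>p. if p \<in> topspace X then g p (V p) (W p) else 0)"

lemma metric_product_smooth:
  assumes "lorentzian_metric X A g" "V \<in> smooth_vector_fields X A" "W \<in> smooth_vector_fields X A"
  shows "metric_product X g V W \<in> smooth_functions X A"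
  using assms by (simp add: lorentzian_metric_def metric_product_def)

lemma null_sections_nonempty:
  assumes st: "spacetime X A g \<tau>" and "parallelizable X A"
  shows "null_sections X A g \<noteq> {}"
proof -
  from st have M: "smooth_manifold X A" and L: "lorentzian_metric X A g"
    and \<tau>: "\<tau> \<in> smooth_vector_fields X A" and timelike: "\<And>p. p \<in> topspace X \<Longrightarrow> g p (\<tau> p) (\<tau> p) < 0"
    by (auto simp: spacetime_def)
  from assms(2) obtain e :: "4 \<Rightarrow> 'a vector_field"
    where e: "\<And>i. e i \<in> smooth_vector_fields X A"
      and basis: "\<And>p. p \<in> topspace X \<Longrightarrow> basis_of (tangent_space X A p) (\<lambda>i. e i p)"
    by (auto simp: parallelizable_def global_frame_def)
  define c where "c i = metric_product X g \<tau> (e i)" for i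
  define Y where "Y = (\<lambda>p. (- c 1 p) *\<^sub>R e 0 p + c 0 p *\<^sub>R e 1 p + (- c 3 p) *\<^sub>R e 2 p + c 2 p *\<^sub>R e 3 p)"
  define u where "u = (\<lambda>p. sqrt (metric_product X g Y Y p) *\<^sub>R \<tau> p
    + sqrt (- metric_product X g \<tau> \<tau> p) *\<^sub>R Y p)"
  note field_smooth = smooth_vector_fields_add[OF M] smooth_vector_fields_scale[OF M]
  note fun_smooth = smooth_functions_uminus[OF M] smooth_functions_sqrt[OF M]
    metric_product_smooth[OF L]
  have c: "c i \<in> smooth_functions X A" for i
    unfolding c_def by (intro fun_smooth \<tau> e)
  have Y: "Y \<in> smooth_vector_fields X A"
    unfolding Y_def by (intro field_smooth fun_smooth c e)
  have orth: "g p (\<tau> p) (Y p) = 0" and spacelike: "0 < g p (Y p) (Y p)" if p: "p \<in> topspace X" for p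
  proof -
    interpret lorentzian_space "tangent_space X A p" "g p"
      by (rule lorentzian_space_tangent_space[OF L p])
    show "g p (\<tau> p) (Y p) = 0" "0 < g p (Y p) (Y p)"
      using twisted_dual_spacelike[OF basis[OF p] smooth_vector_fieldsD(1)[OF \<tau> p] timelike[OF p]] p
      unfolding Y_def c_def metric_product_def by simp_all
  qed
  have "u \<in> null_sections X A g"
  proof (rule null_sectionsI)
    show "u \<in> smooth_vector_fields X A"
      unfolding u_def
      by (intro field_smooth fun_smooth \<tau> Y) (simp_all add: metric_product_def timelike spacelike)
  next
    fix p assume p: "p \<in> topspace X"
    interpret lorentzian_space "tangent_space X A p" "g p"
      by (rule lorentzian_space_tangent_space[OF L p])
    note null = timelike_spacelike_null[OF smooth_vector_fieldsD(1)[OF \<tau> p] timelike[OF p]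
        smooth_vector_fieldsD(1)[OF Y p] orth[OF p] spacelike[OF p]]
    show "g p (u p) (u p) = 0" "u p \<noteq> 0"
      using null p by (simp_all add: u_def metric_product_def)
  qed
  then show ?thesis by blast
qed

lemma null_product_SomeD:
  assumes "null_product X g u v w = Some x"
  shows "p \<in> topspace X \<Longrightarrow> \<not> proportional (v p) (w p)" and "x p = g p (v p) (w p) *\<^sub>R u p"
  using assms by (auto simp: null_product_def split: if_splits)

lemma null_product_closed:
  assumes M: "smooth_manifold X A" and L: "lorentzian_metric X A g"
    and u: "u \<in> null_sections X A g" and v: "v \<in> null_sections X A g"
    and w: "w \<in> null_sections X A g" and prod: "null_product X g u v w = Some x"
  shows "x \<in> null_sections X A g"
proof (rule null_sectionsI)
  have "x = (\<lambda>p. metric_product X g v w p *\<^sub>R u p)"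
    using null_product_SomeD(2)[OF prod] null_sectionsD(5)[OF u]
    by (auto simp: fun_eq_iff[of x] metric_product_def)
  then show "x \<in> smooth_vector_fields X A"
    by (simp add: smooth_vector_fields_scale[OF M] metric_product_smooth[OF L]
          null_sectionsD(1)[OF u] null_sectionsD(1)[OF v] null_sectionsD(1)[OF w])
next
  fix p assume p: "p \<in> topspace X"
  interpret lorentzian_space "tangent_space X A p" "g p"
    by (rule lorentzian_space_tangent_space[OF L p])
  note T = null_sectionsD(2)[OF u p] null_sectionsD(2)[OF v p] null_sectionsD(2)[OF w p]
  show "g p (x p) (x p) = 0"
    using T null_sectionsD(3)[OF u p]
    by (simp add: null_product_SomeD(2)[OF prod] scale_left scale_right subspace_scale[OF subspace])
  have "g p (v p) (w p) \<noteq> 0"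
    using orthogonal_null_imp_proportional[OF T(2) null_sectionsD(3)[OF v p] T(3)
        null_sectionsD(3)[OF w p]] null_product_SomeD(1)[OF prod p] by blast
  then show "x p \<noteq> 0"
    using null_sectionsD(4)[OF u p] by (simp add: null_product_SomeD(2)[OF prod])
qed

lemma null_product_para_associative:
  assumes L: "lorentzian_metric X A g"
    and H: "a \<in> null_sections X A g" "b \<in> null_sections X A g" "c \<in> null_sections X A g"
      "d \<in> null_sections X A g" "e \<in> null_sections X A g"
  defines "y \<equiv> \<lambda>p. (g p (b p) (c p) * g p (d p) (e p)) *\<^sub>R a p"
  shows "null_product X g a b c = Some x \<Longrightarrow> null_product X g x d e = Some z \<Longrightarrow> z = y"
    and "null_product X g d c b = Some x \<Longrightarrow> null_product X g a x e = Some z \<Longrightarrow> z = y"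
    and "null_product X g c d e = Some x \<Longrightarrow> null_product X g a b x = Some z \<Longrightarrow> z = y"
proof -
  \<comment> \<open>Off the manifold the metric is arbitrary, but there \<open>a\<close> vanishes, and with it every product
    that starts with \<open>a\<close>.\<close>
  have off: "q p = y p" if "p \<notin> topspace X" "q p = k *\<^sub>R a p" for p k and q :: "'a vector_field"
    using that null_sectionsD(5)[OF H(1)] by (simp add: y_def)
  note T = H[THEN null_sectionsD(2)]
  {
    assume 1: "null_product X g a b c = Some x" and 2: "null_product X g x d e = Some z"
    show "z = y"
    proof
      fix p show "z p = y p"
        by (simp add: null_product_SomeD(2)[OF 2] null_product_SomeD(2)[OF 1] y_def mult.commute)
    qed
  next
    assume 1: "null_product X g d c b = Some x" and 2: "null_product X g a x e = Some z"
    show "z = y"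
    proof
      fix p show "z p = y p"
      proof (cases "p \<in> topspace X")
        case True
        interpret lorentzian_space "tangent_space X A p" "g p"
          by (rule lorentzian_space_tangent_space[OF L True])
        show ?thesis
          using T[OF True] sym[of "b p" "c p"]
          by (simp add: null_product_SomeD(2)[OF 2] null_product_SomeD(2)[OF 1] y_def scale_left)
      qed (rule off[OF _ null_product_SomeD(2)[OF 2]])
    qed
  next
    assume 1: "null_product X g c d e = Some x" and 2: "null_product X g a b x = Some z"
    show "z = y"
    proof
      fix p show "z p = y p"
      proof (cases "p \<in> topspace X")
        case True
        interpret lorentzian_space "tangent_space X A p" "g p"
          by (rule lorentzian_space_tangent_space[OF L True])
        show ?thesis
          using T[OF True]
          by (simp add: null_product_SomeD(2)[OF 2] null_product_SomeD(2)[OF 1] y_def scale_right)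
      qed (rule off[OF _ null_product_SomeD(2)[OF 2]])
    qed
  }
qed

theorem theorem2p13:
  fixes X :: "'a topology"
    and A :: "('a, real^4) chart set"
    and g :: "'a metric_field"
    and \<tau> :: "'a vector_field"
  assumes "spacetime X A g \<tau>"
    and "parallelizable X A"
  shows "partial_semiheap (null_sections X A g) (null_product X g)"
proof -
  from assms(1) have M: "smooth_manifold X A" and L: "lorentzian_metric X A g"
    by (auto simp: spacetime_def)
  show ?thesis
    unfolding partial_semiheap_def Let_def
  proof (intro conjI ballI allI impI)
    show "null_sections X A g \<noteq> {}"
      by (rule null_sections_nonempty[OF assms])
  next
    fix a b c x
    assume "a \<in> null_sections X A g" "b \<in> null_sections X A g" "c \<in> null_sections X A g"
      and "null_product X g a b c = Some x"
    then show "x \<in> null_sections X A g"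
      by (rule null_product_closed[OF M L])
  next
    fix a b c d e
    assume H: "a \<in> null_sections X A g" "b \<in> null_sections X A g" "c \<in> null_sections X A g"
      "d \<in> null_sections X A g" "e \<in> null_sections X A g"
    let ?l = "Option.bind (null_product X g a b c) (\<lambda>x. null_product X g x d e)"
    let ?m = "Option.bind (null_product X g d c b) (\<lambda>x. null_product X g a x e)"
    let ?r = "Option.bind (null_product X g c d e) (\<lambda>x. null_product X g a b x)"
    let ?y = "\<lambda>p. (g p (b p) (c p) * g p (d p) (e p)) *\<^sub>R a p"
    have l: "?l = Some ?y" if "?l \<noteq> None"
      using that null_product_para_associative(1)[OF L H] by (auto simp: bind_eq_None_conv)
    have m: "?m = Some ?y" if "?m \<noteq> None"
      using that null_product_para_associative(2)[OF L H] by (auto simp: bind_eq_None_conv)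
    have r: "?r = Some ?y" if "?r \<noteq> None"
      using that null_product_para_associative(3)[OF L H] by (auto simp: bind_eq_None_conv)
    show "?l = ?m" if "?l \<noteq> None \<and> ?m \<noteq> None"
      using that l m by metis
    show "?m = ?r" if "?m \<noteq> None \<and> ?r \<noteq> None"
      using that m r by metis
    show "?l = ?r" if "?l \<noteq> None \<and> ?r \<noteq> None"
      using that l r by metis
  qed
qed

end
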